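(* Let $\mathfrak{M}=(V,\langle\cdot,\cdot\rangle,A)$ be a $0$-model of signature $(p,q)$. (1) Let $\mathfrak{M}$ be either Jacobi--Tsankov or mixed-Tsankov. Then $\mathcal{J}(x)^2=0$ for all $x\in V$. Furthermore, if $p=0$ or if $p=1$, then $A=0$. (2) If $\mathfrak{M}$ is Jacobi--Tsankov and if $\dim(V)<14$, then $\mathfrak{M}$ is $2$-step Jacobi nilpotent. (3) The following conditions are equivalent if $\mathfrak{M}$ is indecomposable: (a) $\mathfrak{M}$ is $2$-step Jacobi nilpotent. (b) $\mathfrak{M}$ is $2$-step skew-curvature nilpotent. (c) We can decompose $V=W\oplus\bar W$ for $W$ and $\bar W$ totally isotropic subspaces of $V$ and for $A=A_W\oplus 0$, where the tensor $A_W\in\mathfrak{A}(W)$ is indecomposable.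
   Context: Let $V$ be a finite dimensional real vector space. An algebraic curvature tensor on $V$ is $A\in\otimes^4V^*$ with $A(v_1,v_2,v_3,v_4)=-A(v_2,v_1,v_3,v_4)=A(v_3,v_4,v_1,v_2)$ and $A(v_1,v_2,v_3,v_4)+A(v_2,v_3,v_1,v_4)+A(v_3,v_1,v_2,v_4)=0$; $\mathfrak{A}(V)$ denotes the set of algebraic curvature tensors on $V$. A $0$-model of signature $(p,q)$ is a triple $(V,\langle\cdot,\cdot\rangle,A)$ where $\langle\cdot,\cdot\rangle$ is a non-degenerate symmetric inner product on $V$ of signature $(p,q)$ ($p$ is the number of negative (timelike) directions, so $p=0$ is the Riemannian and $p=1$ the Lorentzian case) and $A\in\mathfrak{A}(V)$. The skew-symmetric curvature operator $\mathcal{A}(x,y)$ is defined by $\langle\mathcal{A}(x,y)z,w\rangle=A(x,y,z,w)$ and the Jacobi operator by $\mathcal{J}(x)y:=\mathcal{A}(y,x)x$. The model $\mathfrak{M}$ is: Jacobi--Tsankov if $\mathcal{J}(x)\mathcal{J}(y)=\mathcal{J}(y)\mathcal{J}(x)$ for all $x,y\in V$; mixed-Tsankov if $\mathcal{A}(x_1,x_2)\mathcal{J}(x_3)=\mathcal{J}(x_3)\mathcal{A}(x_1,x_2)$ for all $x_1,x_2,x_3\in V$; $2$-step Jacobi nilpotent if $\mathcal{J}(x)\mathcal{J}(y)=0$ for all $x,y\in V$; $2$-step skew-curvature nilpotent if $\mathcal{A}(x_1,x_2)\mathcal{A}(x_3,x_4)=0$ for all $x_1,x_2,x_3,x_4\in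 V$. For a direct sum $U=U_1\oplus U_2$ of vector spaces and $A_i\in\mathfrak{A}(U_i)$, $A_1\oplus A_2\in\mathfrak{A}(U)$ is the tensor which restricts to $A_i$ on $U_i$ and vanishes whenever its arguments include vectors from both $U_1$ and $U_2$. The model $\mathfrak{M}$ is indecomposable if there is no non-trivial orthogonal direct sum decomposition $V=V_1\oplus V_2$ with $A=A_1\oplus A_2$ for some $A_i\in\mathfrak{A}(V_i)$; a tensor $A_W\in\mathfrak{A}(W)$ is indecomposable if there is no non-trivial direct sum decomposition $W=W_1\oplus W_2$ with $A_W=A_1\oplus A_2$ for some $A_i\in\mathfrak{A}(W_i)$. A subspace is totally isotropic if $\langle\cdot,\cdot\rangle$ vanishes identically on it.
   Formalization: In (3), the equivalence of (c) with (a) and (b) is stated only for dim(V) ≠ 1: if dim(V) = 1, then A = 0, the model is indecomposable and (a), (b) hold, but (c) fails; (a)⇔(b) is kept in all dimensions. *)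

theory Defs
  imports "HOL-Analysis.Analysis"
begin

text \<open>
  The vector space \<open>V\<close> of a model is a whole type of class \<^class>\<open>real_vector\<close> with a finite
  spanning set; unlike \<^class>\<open>euclidean_space\<close> this admits \<open>V = 0\<close> and carries no preferred
  positive definite inner product. Since tensors on subspaces \<open>W\<close> of \<open>V\<close> are needed as well,
  4-tensors are functions on \<open>V\<close> of which only the values on the subspace in question are
  meaningful.
\<close>

type_synonym 'a tensor4 = "'a \<Rightarrow> 'a \<Rightarrow> 'a \<Rightarrow> 'a \<Rightarrow> real"

definition linear_form_on :: "'a::real_vector set \<Rightarrow> ('a \<Rightarrow> real) \<Rightarrow> bool" where
  "linear_form_on W f \<longleftrightarrow>
     (\<forall>x\<in>W. \<forall>y\<in>W. f (x + y) = f x + f y) \<and> (\<forall>c. \<forall>x\<in>W. f (c *\<^sub>R x) = c * f x)"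

definition multilinear4_on :: "'a::real_vector set \<Rightarrow> 'a tensor4 \<Rightarrow> bool" where
  "multilinear4_on W A \<longleftrightarrow>
     (\<forall>x\<in>W. \<forall>y\<in>W. \<forall>z\<in>W.
        linear_form_on W (\<lambda>v. A v x y z) \<and> linear_form_on W (\<lambda>v. A x v y z) \<and>
        linear_form_on W (\<lambda>v. A x y v z) \<and> linear_form_on W (\<lambda>v. A x y z v))"

definition curvature_tensors :: "'a::real_vector set \<Rightarrow> 'a tensor4 set" where
  "curvature_tensors W = {A. multilinear4_on W A \<and>
     (\<forall>v1\<in>W. \<forall>v2\<in>W. \<forall>v3\<in>W. \<forall>v4\<in>W.
        A v1 v2 v3 v4 = - A v2 v1 v3 v4 \<and>
        A v1 v2 v3 v4 = A v3 v4 v1 v2 \<and>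
        A v1 v2 v3 v4 + A v2 v3 v1 v4 + A v3 v1 v2 v4 = 0)}"

definition nondegenerate :: "('a::real_vector \<Rightarrow> 'a \<Rightarrow> real) \<Rightarrow> bool" where
  "nondegenerate g \<longleftrightarrow> (\<forall>x. (\<forall>y. g x y = 0) \<longrightarrow> x = 0)"

text \<open>
  Signature \<open>(p, q)\<close>: there is an orthonormal basis with \<open>p\<close> timelike (\<open>N\<close>) and \<open>q\<close> spacelike
  (\<open>P\<close>) vectors.
\<close>

definition has_signature :: "('a::real_vector \<Rightarrow> 'a \<Rightarrow> real) \<Rightarrow> nat \<Rightarrow> nat \<Rightarrow> bool" where
  "has_signature g p q \<longleftrightarrow>
     (\<exists>N P. finite N \<and> finite P \<and> N \<inter> P = {} \<and> card N = p \<and> card P = q \<and>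
        independent (N \<union> P) \<and> span (N \<union> P) = UNIV \<and>
        (\<forall>e\<in>N. g e e = - 1) \<and> (\<forall>e\<in>P. g e e = 1) \<and>
        (\<forall>e\<in>N \<union> P. \<forall>f\<in>N \<union> P. e \<noteq> f \<longrightarrow> g e f = 0))"

definition zero_model ::
  "('a::real_vector \<Rightarrow> 'a \<Rightarrow> real) \<Rightarrow> 'a tensor4 \<Rightarrow> nat \<Rightarrow> nat \<Rightarrow> bool" where
  "zero_model g A p q \<longleftrightarrow>
     (\<exists>B. finite B \<and> span B = (UNIV :: 'a set)) \<and>
     bilinear g \<and> (\<forall>x y. g x y = g y x) \<and> nondegenerate g \<and> has_signature g p q \<and>
     A \<in> curvature_tensors UNIV"

text \<open>
  In a 0-model the description below determines the vector uniquely, because the inner product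
  is nondegenerate and the space finite dimensional.
\<close>

definition skew_op ::
  "('a::real_vector \<Rightarrow> 'a \<Rightarrow> real) \<Rightarrow> 'a tensor4 \<Rightarrow> 'a \<Rightarrow> 'a \<Rightarrow> 'a \<Rightarrow> 'a" where
  "skew_op g A x y z = (THE u. \<forall>w. g u w = A x y z w)"

definition jacobi_op ::
  "('a::real_vector \<Rightarrow> 'a \<Rightarrow> real) \<Rightarrow> 'a tensor4 \<Rightarrow> 'a \<Rightarrow> 'a \<Rightarrow> 'a" where
  "jacobi_op g A x y = skew_op g A y x x"

definition jacobi_tsankov :: "('a::real_vector \<Rightarrow> 'a \<Rightarrow> real) \<Rightarrow> 'a tensor4 \<Rightarrow> bool" where
  "jacobi_tsankov g A \<longleftrightarrow>
     (\<forall>x y. jacobi_op g A x \<circ> jacobi_op g A y = jacobi_op g A y \<circ> jacobi_op g A x)"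

definition mixed_tsankov :: "('a::real_vector \<Rightarrow> 'a \<Rightarrow> real) \<Rightarrow> 'a tensor4 \<Rightarrow> bool" where
  "mixed_tsankov g A \<longleftrightarrow>
     (\<forall>x1 x2 x3. skew_op g A x1 x2 \<circ> jacobi_op g A x3 = jacobi_op g A x3 \<circ> skew_op g A x1 x2)"

definition two_step_jacobi_nilpotent ::
  "('a::real_vector \<Rightarrow> 'a \<Rightarrow> real) \<Rightarrow> 'a tensor4 \<Rightarrow> bool" where
  "two_step_jacobi_nilpotent g A \<longleftrightarrow>
     (\<forall>x y. jacobi_op g A x \<circ> jacobi_op g A y = (\<lambda>_. 0))"

definition two_step_skew_nilpotent ::
  "('a::real_vector \<Rightarrow> 'a \<Rightarrow> real) \<Rightarrow> 'a tensor4 \<Rightarrow> bool" where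
  "two_step_skew_nilpotent g A \<longleftrightarrow>
     (\<forall>x1 x2 x3 x4. skew_op g A x1 x2 \<circ> skew_op g A x3 x4 = (\<lambda>_. 0))"

definition is_direct_sum ::
  "'a::real_vector set \<Rightarrow> 'a set \<Rightarrow> 'a set \<Rightarrow> bool" where
  "is_direct_sum U U1 U2 \<longleftrightarrow>
     subspace U1 \<and> subspace U2 \<and> U1 \<inter> U2 = {0} \<and> U = {x + y |x y. x \<in> U1 \<and> y \<in> U2}"

text \<open>
  \<open>is_tensor_sum U1 U2 A1 A2 A\<close> says \<open>A = A1 \<oplus> A2\<close>. If \<open>U\<close> is the direct sum of \<open>U1\<close> and
  \<open>U2\<close>, these conditions determine a multilinear \<open>A\<close> on all of \<open>U\<close>.
\<close>

definition is_tensor_sum ::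
  "'a::real_vector set \<Rightarrow> 'a set \<Rightarrow> 'a tensor4 \<Rightarrow> 'a tensor4 \<Rightarrow> 'a tensor4 \<Rightarrow> bool" where
  "is_tensor_sum U1 U2 A1 A2 A \<longleftrightarrow>
     (\<forall>x1\<in>U1. \<forall>x2\<in>U1. \<forall>x3\<in>U1. \<forall>x4\<in>U1. A x1 x2 x3 x4 = A1 x1 x2 x3 x4) \<and>
     (\<forall>x1\<in>U2. \<forall>x2\<in>U2. \<forall>x3\<in>U2. \<forall>x4\<in>U2. A x1 x2 x3 x4 = A2 x1 x2 x3 x4) \<and>
     (\<forall>x1 x2 x3 x4. {x1, x2, x3, x4} \<subseteq> U1 \<union> U2 \<and>
        {x1, x2, x3, x4} \<inter> U1 \<noteq> {} \<and> {x1, x2, x3, x4} \<inter> U2 \<noteq> {} \<longrightarrow> A x1 x2 x3 x4 = 0)"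

definition indecomposable_model :: "('a::real_vector \<Rightarrow> 'a \<Rightarrow> real) \<Rightarrow> 'a tensor4 \<Rightarrow> bool" where
  "indecomposable_model g A \<longleftrightarrow>
     \<not> (\<exists>V1 V2 A1 A2. V1 \<noteq> {0} \<and> V2 \<noteq> {0} \<and> is_direct_sum UNIV V1 V2 \<and>
          (\<forall>x\<in>V1. \<forall>y\<in>V2. g x y = 0) \<and>
          A1 \<in> curvature_tensors V1 \<and> A2 \<in> curvature_tensors V2 \<and>
          is_tensor_sum V1 V2 A1 A2 A)"

definition indecomposable_tensor :: "'a::real_vector set \<Rightarrow> 'a tensor4 \<Rightarrow> bool" where
  "indecomposable_tensor W AW \<longleftrightarrow>
     \<not> (\<exists>W1 W2 A1 A2. W1 \<noteq> {0} \<and> W2 \<noteq> {0} \<and> is_direct_sum W W1 W2 \<and>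
          A1 \<in> curvature_tensors W1 \<and> A2 \<in> curvature_tensors W2 \<and>
          is_tensor_sum W1 W2 A1 A2 AW)"

definition totally_isotropic :: "('a::real_vector \<Rightarrow> 'a \<Rightarrow> real) \<Rightarrow> 'a set \<Rightarrow> bool" where
  "totally_isotropic g W \<longleftrightarrow> (\<forall>x\<in>W. \<forall>y\<in>W. g x y = 0)"

definition isotropic_splitting :: "('a::real_vector \<Rightarrow> 'a \<Rightarrow> real) \<Rightarrow> 'a tensor4 \<Rightarrow> bool" where
  "isotropic_splitting g A \<longleftrightarrow>
     (\<exists>W W' AW. is_direct_sum UNIV W W' \<and> totally_isotropic g W \<and> totally_isotropic g W' \<and>
        AW \<in> curvature_tensors W \<and> indecomposable_tensor W AW \<and>
        is_tensor_sum W W' AW (\<lambda>_ _ _ _. 0) A)"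

end

theory Submission
  imports Defs
begin

text \<open>
  (1) Commutation gives \<open>J(u) J(x) u = 0\<close>, respectively \<open>J(x) A(y, x) x = 0\<close>; in either case
  \<open>J(x)\<^sup>2 = 0\<close>, after polarizing the former in \<open>u\<close>. Hence \<open>J(x) y\<close> is a null vector
  orthogonal to \<open>x\<close>, which in the Lorentzian case vanishes for timelike \<open>x\<close> and then, by
  polarization around a timelike vector, for all \<open>x\<close>.

  (2) Let \<open>J(a, b)\<close> be the polarized Jacobi operator. The form
  \<open>F(ab|cd|ef) = \<langle>J(a, b) J(c, d) e, f\<rangle>\<close> is symmetric under permutations of the three
  pairs and satisfies the Bianchi identity, so it vanishes as soon as one argument occurs three
  times. If \<open>J(x) J(y) \<noteq> 0\<close>, then \<open>F(xx|yy|zz) \<noteq> 0\<close> for some \<open>z\<close>, and the Gram matrix shows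
  that 3 + 8 + 3 vectors built from \<open>x, y, z\<close> are independent.

  (3) Let \<open>K\<close> be the kernel of \<open>A\<close>; its orthogonal complement is spanned by the range of the
  curvature operators. Thus 2-step skew-curvature nilpotency says that \<open>K\<close> contains its
  orthogonal complement. A non-null vector of \<open>K\<close> would split off, so \<open>K\<close> is totally isotropic,
  hence Lagrangian, and has a Lagrangian complement \<open>W\<close>. A decomposition \<open>W = W1 \<oplus> W2\<close> extends
  to one of the model by adding to each \<open>Wi\<close> the annihilator in \<open>K\<close> of the other summand.
\<close>

section \<open>Linear forms and independence from a triangular Gram matrix\<close>

lemma linear_form_on_UNIV: "linear_form_on UNIV f \<longleftrightarrow> linear f"
  unfolding linear_form_on_def by (auto simp: linear_iff)

primrec triangular_pairing ::
  "('a::real_vector \<Rightarrow> 'a \<Rightarrow> real) \<Rightarrow> ('a \<times> 'a) list \<Rightarrow> bool" where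
  "triangular_pairing g [] = True"
| "triangular_pairing g (p # ps) =
     (g (fst p) (snd p) \<noteq> 0 \<and> (\<forall>q\<in>set ps. g (fst q) (snd p) = 0) \<and> triangular_pairing g ps)"

text \<open>The form \<open>g _ (snd p)\<close> kills all later vectors, hence their span, but not
  \<open>fst p\<close>.\<close>

lemma triangular_pairing_independent:
  assumes "bilinear g" "triangular_pairing g ps"
  shows "independent (fst ` set ps)" and "card (fst ` set ps) = length ps"
proof -
  have "independent (fst ` set ps) \<and> card (fst ` set ps) = length ps"
    using assms(2)
  proof (induction ps)
    case Nil
    then show ?case by (simp add: independent_empty)
  next
    case (Cons p ps)
    have lin: "linear (\<lambda>v. g v (snd p))"
      using assms(1) by (simp add: bilinear_def)
    have "g v (snd p) = 0" if "v \<in> span (fst ` set ps)" for v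
      using linear_eq_0_on_span[OF lin _ that] Cons.prems by force
    with Cons.prems have "fst p \<notin> span (fst ` set ps)" by auto
    moreover from this have "fst p \<notin> fst ` set ps"
      using span_base[of "fst p" "fst ` set ps"] by argo
    ultimately show ?case
      using Cons by (simp add: independent_insertI)
  qed
  then show "independent (fst ` set ps)" and "card (fst ` set ps) = length ps" by auto
qed

section \<open>Nondegenerate inner products in an orthonormal basis\<close>

locale curvature_model =
  fixes g :: "'a::real_vector \<Rightarrow> 'a \<Rightarrow> real" and A :: "'a tensor4" and N P :: "'a set"
  assumes bil: "bilinear g"
    and g_sym: "g x y = g y x"
    and nondeg: "nondegenerate g"
    and fin: "finite N" "finite P"
    and disj: "N \<inter> P = {}"
    and indep: "independent (N \<union> P)"
    and span_UNIV: "span (N \<union> P) = UNIV"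
    and timelike: "e \<in> N \<Longrightarrow> g e e = - 1"
    and spacelike: "e \<in> P \<Longrightarrow> g e e = 1"
    and orth: "\<lbrakk>e \<in> N \<union> P; f \<in> N \<union> P; e \<noteq> f\<rbrakk> \<Longrightarrow> g e f = 0"
    and curv: "A \<in> curvature_tensors UNIV"
begin

lemma g_linear1: "linear (\<lambda>x. g x y)" and g_linear2: "linear (g x)"
  using bil by (auto simp: bilinear_def)

lemmas g_simps =
  linear_add[OF g_linear1] linear_add[OF g_linear2]
  linear_diff[OF g_linear1] linear_diff[OF g_linear2]
  linear_neg[OF g_linear1] linear_neg[OF g_linear2]
  linear_0[OF g_linear1] linear_0[OF g_linear2]
  linear_cmul[OF g_linear1, simplified] linear_cmul[OF g_linear2, simplified]

lemma g_eqI: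
  assumes "\<And>w. g u w = g v w" shows "u = v"
proof -
  have "g (u - v) w = 0" for w using assms by (simp add: g_simps)
  then have "u - v = 0" using nondeg unfolding nondegenerate_def by blast
  then show ?thesis by simp
qed

lemma dim_UNIV: "dim (UNIV :: 'a set) = card (N \<union> P)"
  using dim_eq_card[of "N \<union> P" UNIV] indep span_UNIV by simp

lemma length_le_dim:
  assumes "triangular_pairing g ps" shows "length ps \<le> dim (UNIV :: 'a set)"
  using independent_span_bound[of "N \<union> P" "fst ` set ps"] fin span_UNIV dim_UNIV
    triangular_pairing_independent[OF bil assms] by simp

text \<open>It suffices to compare both sides on the basis, where each sign \<open>g e e\<close> is
  its own inverse.\<close>

lemma g_representation:
  assumes "linear f"
  shows "g (\<Sum>e\<in>N \<union> P. (f e * g e e) *\<^sub>R e) w = f w"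
proof -
  let ?u = "\<Sum>e\<in>N \<union> P. (f e * g e e) *\<^sub>R e"
  have "g ?u b = f b" if b: "b \<in> N \<union> P" for b
  proof -
    have "g ?u b = (\<Sum>e\<in>N \<union> P. f e * g e e * g e b)"
      by (simp add: linear_sum[OF g_linear1] g_simps)
    also have "\<dots> = (\<Sum>e\<in>N \<union> P. if e = b then f b else 0)"
      using b orth timelike spacelike by (intro sum.cong) auto
    also have "\<dots> = f b" using b fin by simp
    finally show ?thesis .
  qed
  then show ?thesis
    using linear_eq_on_span[OF g_linear2 assms, of "N \<union> P" ?u w] span_UNIV by simp
qed

lemma g_representation_ex: "linear f \<Longrightarrow> \<exists>u. \<forall>w. g u w = f w"
  using g_representation by blast

lemma g_expansion:
  "g v w = (\<Sum>e\<in>P. g v e * g w e) - (\<Sum>e\<in>N. g v e * g w e)"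
proof -
  have "v = (\<Sum>e\<in>N \<union> P. (g v e * g e e) *\<^sub>R e)"
    by (intro g_eqI) (simp add: g_representation g_linear2)
  then have "g v w = g (\<Sum>e\<in>N \<union> P. (g v e * g e e) *\<^sub>R e) w" by simp
  also have "\<dots> = (\<Sum>e\<in>N \<union> P. g v e * g e e * g w e)"
    by (simp add: linear_sum[OF g_linear1] g_simps g_sym[of w])
  also have "\<dots> = (\<Sum>e\<in>N. g v e * g e e * g w e) + (\<Sum>e\<in>P. g v e * g e e * g w e)"
    using fin disj by (intro sum.union_disjoint)
  also have "\<dots> = (\<Sum>e\<in>P. g v e * g w e) - (\<Sum>e\<in>N. g v e * g w e)"
    by (simp add: timelike spacelike sum_negf)
  finally show ?thesis .
qed

section \<open>Curvature symmetries and the polarized Jacobi operator\<close>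

lemma A_linear:
  "linear (\<lambda>v. A v x y z)" "linear (\<lambda>v. A x v y z)"
  "linear (\<lambda>v. A x y v z)" "linear (\<lambda>v. A x y z v)"
  using curv[unfolded curvature_tensors_def, THEN CollectD, THEN conjunct1,
      unfolded multilinear4_on_def linear_form_on_UNIV, rule_format, OF UNIV_I UNIV_I UNIV_I]
  by blast+

lemmas A_simps =
  A_linear[THEN linear_add] A_linear[THEN linear_diff] A_linear[THEN linear_neg]
  A_linear[THEN linear_0] A_linear[THEN linear_cmul, simplified]

lemma A_skew: "A x y z w = - A y x z w"
  and A_pair: "A x y z w = A z w x y"
  and A_bianchi: "A x y z w + A y z x w + A z x y w = 0"
  using curv[unfolded curvature_tensors_def, THEN CollectD, THEN conjunct2, rule_format,
      OF UNIV_I UNIV_I UNIV_I UNIV_I]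
  by blast+

lemma A_skew2: "A x y z w = - A x y w z"
  using A_pair[of x y z w] A_skew[of z w x y] A_pair[of w z x y] by simp

abbreviation R :: "'a \<Rightarrow> 'a \<Rightarrow> 'a \<Rightarrow> 'a" where
  "R \<equiv> skew_op g A"

text \<open>Linear forms are represented by vectors, and uniquely so by nondegeneracy; hence the
  definite description in \<open>skew_op\<close> is meaningful.\<close>

lemma g_R: "g (R x y z) w = A x y z w"
proof -
  obtain u where u: "\<forall>w. g u w = A x y z w"
    using g_representation_ex[OF A_linear(4)] by blast
  have "\<forall>w. g (R x y z) w = A x y z w"
    unfolding skew_op_def by (rule theI[of _ u]) (auto intro: g_eqI simp: u)
  then show ?thesis by blast
qed

definition j :: "'a \<Rightarrow> 'a \<Rightarrow> 'a \<Rightarrow> 'a" where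
  "j x y z = (1/2) *\<^sub>R (R z x y + R z y x)"

lemma g_j: "g (j x y z) w = (A z x y w + A z y x w) / 2"
  by (simp add: j_def g_simps g_R)

lemma jacobi_op_eq: "jacobi_op g A x = j x x"
  by (rule ext) (simp add: jacobi_op_def j_def flip: scaleR_2)

lemma j_linear: "linear (\<lambda>v. j v y z)" "linear (\<lambda>v. j x v z)" "linear (\<lambda>v. j x y v)"
  unfolding linear_iff
  by (auto intro!: g_eqI simp: g_simps g_j A_simps field_simps)

lemmas j_simps =
  j_linear[THEN linear_add] j_linear[THEN linear_diff] j_linear[THEN linear_neg]
  j_linear[THEN linear_0] j_linear[THEN linear_cmul]

lemmas j3_simps =
  j_linear(3)[THEN linear_add] j_linear(3)[THEN linear_diff] j_linear(3)[THEN linear_0]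
  j_linear(3)[THEN linear_cmul]

lemma j_commute: "j x y = j y x"
  by (rule ext) (simp add: j_def add.commute)

lemma j_self [simp]: "j x x x = 0"
  by (rule g_eqI) (use A_skew[of x x x] in \<open>simp add: g_j g_simps\<close>)

text \<open>The six terms cancel in pairs by skewness of \<open>A\<close> in its first two
  arguments.\<close>

lemma j_bianchi: "j x y z + j y z x + j z x y = 0"
proof (rule g_eqI)
  fix w
  show "g (j x y z + j y z x + j z x y) w = g 0 w"
    using A_skew[of x y z w] A_skew[of y z x w] A_skew[of z x y w]
    by (simp add: g_simps g_j field_simps)
qed

lemma j_selfadjoint: "g (j x y z) w = g z (j x y w)"
proof -
  have "A z x y w = A w y x z" "A z y x w = A w x y z"
    using A_pair[of z x y w] A_skew[of y w z x] A_skew2[of w y z x]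
      A_pair[of z y x w] A_skew[of x w z y] A_skew2[of w x z y] by simp_all
  then show ?thesis by (simp add: g_sym[of z] g_j)
qed

text \<open>The Jacobi operators determine \<open>A\<close>: in the difference on the right,
  skewness yields two halves of \<open>A x y z w\<close> and the Bianchi identity a third, whence
  the factor \<open>2/3\<close>.\<close>

lemma A_eq_j: "A x y z w = 2/3 * (g (j y z x) w - g (j x z y) w)"
  using A_bianchi[of x y z w] A_skew[of x z y w] A_skew[of y x z w] unfolding g_j by argo

lemma R_eq_j: "R x y z = (2/3) *\<^sub>R (j y z x - j x z y)"
  by (rule g_eqI) (simp add: g_R g_simps A_eq_j)

lemma j_polar: "j x y z = (1/2) *\<^sub>R (j (x + y) (x + y) z - j x x z - j y y z)"
proof -
  have "j (x + y) (x + y) z - j x x z - j y y z = 2 *\<^sub>R j x y z"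
    using j_commute[of x y] by (simp add: j_simps scaleR_2)
  then show ?thesis by simp
qed

lemma A_eq_0_if_jacobi_0:
  assumes "\<And>x y. j x x y = 0"
  shows "A = (\<lambda>_ _ _ _. 0)"
proof -
  have "j x y z = 0" for x y z
    by (subst j_polar) (simp add: assms)
  then show ?thesis
    by (intro ext) (simp add: A_eq_j g_simps)
qed

lemma jacobi_parallelogram:
  "j (x + y) (x + y) z + j (x - y) (x - y) z = 2 *\<^sub>R j x x z + 2 *\<^sub>R j y y z"
  by (simp add: j_simps scaleR_2)

section \<open>Tsankov conditions: square-zero Jacobi operators, Riemannian and Lorentzian
  signature\<close>

lemma jacobi_tsankov_polar:
  assumes "jacobi_tsankov g A"
  shows "j a b (j c d z) = j c d (j a b z)"
proof -
  have comm: "j x x (j y y z) = j y y (j x x z)" for x y z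
  proof -
    have "j x x \<circ> j y y = j y y \<circ> j x x"
      using assms unfolding jacobi_tsankov_def jacobi_op_eq by blast
    from fun_cong[OF this, of z] show ?thesis by simp
  qed
  have comm': "j a b (j y y z) = j y y (j a b z)" for y z
    unfolding j_polar[of a b] j3_simps comm[of _ y] ..
  show ?thesis
    unfolding j_polar[of c d] j3_simps comm' ..
qed

lemma jacobi_squared_0:
  assumes "jacobi_tsankov g A \<or> mixed_tsankov g A"
  shows "j x x (j x x y) = 0"
  using assms
proof
  assume "jacobi_tsankov g A"
  then have 0: "j u u (j x x u) = 0" for u x
    by (subst jacobi_tsankov_polar) (auto simp: j_simps)
  \<comment> \<open>For \<open>u = y + x\<close> and \<open>u = y - x\<close> the inner vector
    \<open>j x x u\<close> is \<open>j x x y\<close>. Adding the two identities cancels the mixed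
    terms, and the term \<open>j y y (j x x y)\<close> vanishes by \<open>0\<close>.\<close>
  have "j (y + x) (y + x) (j x x y) = 0"
    using 0[of "y + x" x] by (simp only: j3_simps j_self add_0_right)
  moreover have "j (y - x) (y - x) (j x x y) = 0"
    using 0[of "y - x" x] by (simp only: j3_simps j_self diff_0_right)
  ultimately show ?thesis
    using jacobi_parallelogram[of y x "j x x y"] 0[of y x] by simp
next
  assume "mixed_tsankov g A"
  then have "j x x (R y x x) = R y x (j x x x)"
    unfolding mixed_tsankov_def jacobi_op_eq by (metis comp_apply)
  moreover have "R y x 0 = 0"
    by (rule g_eqI) (simp add: g_R A_simps g_simps)
  moreover have "R y x x = j x x y"
    by (simp add: j_def flip: scaleR_2)
  ultimately show ?thesis by simp
qed

text \<open>For a single timelike direction this is Cauchy-Schwarz for the spacelike parts: a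
  nonzero timelike component of \<open>v\<close> would make the spacelike part of \<open>u\<close>
  at least as long as its timelike part. Once that component is zero, nullity kills the spacelike
  ones.\<close>

lemma null_orthogonal_timelike_eq_0:
  assumes "card N \<le> 1" and "g v v = 0" and "N = {} \<or> g u u < 0 \<and> g u v = 0"
  shows "v = 0"
proof -
  have P0: "v = 0" if "(\<Sum>e\<in>P. (g v e)\<^sup>2) = 0" "\<And>e. e \<in> N \<Longrightarrow> g v e = 0"
  proof (rule g_eqI)
    have "g v e = 0" if "e \<in> P" for e
      using sum_nonneg_eq_0_iff[OF fin(2), of "\<lambda>e. (g v e)\<^sup>2"] \<open>(\<Sum>e\<in>P. (g v e)\<^sup>2) = 0\<close> that
      by simp
    then show "g v w = g 0 w" for w
      using g_expansion[of v w] that(2) by (simp add: g_simps)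
  qed
  show ?thesis
  proof (cases "N = {}")
    case True
    then show ?thesis
      using P0 g_expansion[of v v] assms(2) by (simp add: power2_eq_square)
  next
    case False
    with assms(1) obtain e0 where N: "N = {e0}"
      by (metis card_1_singletonE card_eq_0_iff fin(1) less_one linorder_not_le order_le_less)
    let ?S = "\<lambda>a b. \<Sum>e\<in>P. g a e * g b e"
    have *: "?S v v = (g v e0)\<^sup>2" "?S u u < (g u e0)\<^sup>2" "?S u v = g u e0 * g v e0"
      using g_expansion[of v v] g_expansion[of u u] g_expansion[of u v] assms(2,3) False
      by (auto simp: N power2_eq_square)
    have "(?S u v)\<^sup>2 \<le> ?S u u * ?S v v"
      using Cauchy_Schwarz_ineq_sum[of "g u" "g v" P] by (simp add: power2_eq_square)
    then have "(g u e0)\<^sup>2 * (g v e0)\<^sup>2 \<le> ?S u u * (g v e0)\<^sup>2"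
      using * by (simp add: power_mult_distrib)
    then have "(g v e0)\<^sup>2 = 0"
      using *(2) by (metis linorder_not_le mult_less_cancel_right_pos zero_less_power2 zero_eq_power2)
    then show ?thesis
      using * P0 N by (simp add: power2_eq_square)
  qed
qed

lemma A_eq_0_if_card_N_le_1:
  assumes "jacobi_tsankov g A \<or> mixed_tsankov g A" and "card N \<le> 1"
  shows "A = (\<lambda>_ _ _ _. 0)"
proof (rule A_eq_0_if_jacobi_0)
  have null: "g (j x x y) (j x x y) = 0" for x y
    by (simp add: j_selfadjoint jacobi_squared_0[OF assms(1)] g_simps)
  have tl: "j x x y = 0" if "N = {} \<or> g x x < 0" for x y
    by (rule null_orthogonal_timelike_eq_0[OF assms(2) null, of x])
      (use that in \<open>auto simp: g_simps simp flip: j_selfadjoint\<close>)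
  fix x y
  show "j x x y = 0"
  proof (cases "N = {}")
    case False
    then obtain e0 where e0: "e0 \<in> N" by blast
    \<comment> \<open>Choose \<open>t\<close> so small that \<open>e0 \<plusminus> t x\<close> is still timelike.\<close>
    define c where "c = 2 * \<bar>g e0 x\<bar> + \<bar>g x x\<bar>"
    define t where "t = 1 / (c + 1)"
    have c: "c \<ge> 0" by (simp add: c_def)
    then have t: "0 < t" "t \<le> 1" "t * c < 1" by (auto simp: t_def field_simps)
    have bound: "2 * t * \<bar>g e0 x\<bar> + t * t * g x x < 1"
    proof -
      have "t * t * g x x \<le> t * t * \<bar>g x x\<bar>"
        by (simp add: mult_left_mono)
      also have "\<dots> \<le> t * 1 * \<bar>g x x\<bar>"
        using t by (intro mult_right_mono mult_left_mono) auto
      finally have "t * t * g x x \<le> t * \<bar>g x x\<bar>" by simp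
      then show ?thesis using t(3) by (simp add: c_def algebra_simps)
    qed
    have "t * g e0 x \<le> t * \<bar>g e0 x\<bar>" "- (t * g e0 x) \<le> t * \<bar>g e0 x\<bar>"
      using t mult_left_mono[of "g e0 x" "\<bar>g e0 x\<bar>" t] mult_left_mono[of "- g e0 x" "\<bar>g e0 x\<bar>" t]
      by auto
    then have "g (e0 + t *\<^sub>R x) (e0 + t *\<^sub>R x) < 0" "g (e0 - t *\<^sub>R x) (e0 - t *\<^sub>R x) < 0"
      using bound by (simp_all add: g_simps timelike[OF e0] g_sym[of x e0] algebra_simps)
    moreover have "g e0 e0 < 0" using timelike[OF e0] by simp
    \<comment> \<open>All of \<open>e0\<close>, \<open>e0 + t x\<close> and \<open>e0 - t x\<close>
      are timelike, so only one term of the parallelogram identity survives.\<close>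
    ultimately have "2 *\<^sub>R j (t *\<^sub>R x) (t *\<^sub>R x) y = 0"
      using jacobi_parallelogram[of e0 "t *\<^sub>R x" y] tl by simp
    then show ?thesis using t by (simp add: j_simps)
  qed (simp add: tl)
qed


section \<open>The six-linear form of a Jacobi-Tsankov model and the dimension bound\<close>

definition F :: "'a \<Rightarrow> 'a \<Rightarrow> 'a \<Rightarrow> 'a \<Rightarrow> 'a \<Rightarrow> 'a \<Rightarrow> real" where
  "F a b c d e f = g (j a b e) (j c d f)"

lemma F_symmetries:
  assumes jt: "jacobi_tsankov g A"
  shows "F a b c d e f = F b a c d e f" "F a b c d e f = F a b d c e f"
    "F a b c d e f = F a b c d f e" "F a b c d e f = F c d a b e f"
    "F a b c d e f = F a b e f c d"
    "F a b c d e f + F a b d e c f + F a b e c d f = 0"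
proof -
  note comm = jacobi_tsankov_polar[OF jt]
  show "F a b c d e f = F b a c d e f" "F a b c d e f = F a b d c e f" for a b c d e f
    by (simp_all only: F_def j_commute[of a] j_commute[of c])
  have swap: "F a b c d e f = F a b c d f e" for a b c d e f
    by (metis F_def comm g_sym j_selfadjoint)
  then show "F a b c d e f = F a b c d f e" .
  have bianchi: "F a b c d e f + F a b d e c f + F a b e c d f = 0" for c d e f
  proof -
    have "F a b c d e f + F a b d e c f + F a b e c d f
        = g (j a b f) (j c d e + j d e c + j e c d)"
      using swap[of a b c d e f] swap[of a b d e c f] swap[of a b e c d f]
      unfolding F_def g_simps by linarith
    then show ?thesis by (simp add: j_bianchi g_simps)
  qed
  then show "F a b c d e f + F a b d e c f + F a b e c d f = 0" .
  \<comment> \<open>For fixed \<open>a\<close>, \<open>b\<close> the form is symmetric within each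
    remaining pair and satisfies the cyclic identity. Four instances of the latter exchange the
    pairs, as in the classical derivation of the pair symmetry of curvature tensors.\<close>
  have "F a b c d e f = F a b d c e f" for c d e f
    by (simp only: F_def j_commute[of c])
  then show "F a b c d e f = F a b e f c d"
    using bianchi[of c d e f] bianchi[of c d f e] bianchi[of c e f d] bianchi[of d e f c]
      swap[of a b c d e f] swap[of a b e f c d] swap[of a b c e d f] swap[of a b d f c e]
      swap[of a b c f d e] swap[of a b d e c f]
    by (smt (verit))
  show "F a b c d e f = F c d a b e f"
    using swap by (metis F_def g_sym)
qed

text \<open>Up to symmetry, three equal arguments either fill one pair and meet another, where
  \<open>j t t t = 0\<close> applies, or meet every pair, where the cyclic identity reduces to the
  first case. All 20 placements are listed for use as rewrite rules.\<close>

lemma F_thrice: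
  assumes jt: "jacobi_tsankov g A"
  shows
    "F t t t d e f = 0" "F t t c t e f = 0" "F t t c d t f = 0" "F t t c d e t = 0"
    "F t b t t e f = 0" "F a t t t e f = 0" "F a b t t t f = 0" "F a b t t e t = 0"
    "F t b c d t t = 0" "F a t c d t t = 0" "F a b t d t t = 0" "F a b c t t t = 0"
    "F t b t d t f = 0" "F t b t d e t = 0" "F t b c t t f = 0" "F t b c t e t = 0"
    "F a t t d t f = 0" "F a t t d e t = 0" "F a t c t t f = 0" "F a t c t e t = 0"
proof -
  note sym = F_symmetries[OF jt]
  have 0: "F a b t t t f = 0" for a b f
    by (subst sym(3)) (simp add: F_def j_selfadjoint[of _ _ _ "j t t t"] g_simps)
  have 1: "F t b t d t f = 0" for b d f
  proof -
    have "F t b d t t f = F t b t d t f" by (rule sym(2))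
    moreover have "F t b t t d f = 0" by (metis 0 sym(4) sym(5))
    ultimately show ?thesis
      using sym(6)[of t b t d t f] by simp
  qed
  show "F a b t t t f = 0" by (rule 0)
  show "F a b t t e t = 0" by (metis 0 sym(3))
  show "F a b t d t t = 0" by (metis 0 sym(5))
  show "F a b c t t t = 0" by (metis 0 sym(5) sym(2))
  show "F t t c d t f = 0" by (metis 0 sym(4))
  show "F t t c d e t = 0" by (metis 0 sym(4) sym(3))
  show "F t b c d t t = 0" by (metis 0 sym(4) sym(5))
  show "F a t c d t t = 0" by (metis 0 sym(4) sym(5) sym(1))
  show "F t t t d e f = 0" by (metis 0 sym(4) sym(5))
  show "F t t c t e f = 0" by (metis 0 sym(4) sym(5) sym(2))
  show "F t b t t e f = 0" by (metis 0 sym(4) sym(5))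
  show "F a t t t e f = 0" by (metis 0 sym(4) sym(5) sym(1))
  show "F t b t d t f = 0" by (rule 1)
  show "F t b t d e t = 0" by (metis 1 sym(3))
  show "F t b c t t f = 0" by (metis 1 sym(2))
  show "F t b c t e t = 0" by (metis 1 sym(2) sym(3))
  show "F a t t d t f = 0" by (metis 1 sym(1))
  show "F a t t d e t = 0" by (metis 1 sym(1) sym(3))
  show "F a t c t t f = 0" by (metis 1 sym(1) sym(2))
  show "F a t c t e t = 0" by (metis 1 sym(1) sym(2) sym(3))
qed

text \<open>If \<open>a\<close> or \<open>b\<close> is \<open>x\<close> or \<open>y\<close>,
  commuting produces a factor \<open>j t b (j t t w)\<close>, which vanishes because
  \<open>t\<close> occurs three times in \<open>F\<close>. Otherwise both are \<open>z\<close>, and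
  commuting moves \<open>j z z\<close> onto \<open>z\<close>.\<close>

lemma jacobi_triple_product_0:
  assumes jt: "jacobi_tsankov g A" and "a \<in> {x, y, z}" "b \<in> {x, y, z}"
  shows "j a b (j x x (j y y z)) = 0"
proof -
  note comm = jacobi_tsankov_polar[OF jt]
  have 0: "j t b (j t t w) = 0" for t b w
  proof (rule g_eqI)
    fix v
    have "g (j t b (j t t w)) v = F t t t b w v"
      by (metis F_def j_selfadjoint)
    then show "g (j t b (j t t w)) v = g 0 v"
      using F_thrice(1)[OF jt] by (simp add: g_simps)
  qed
  have x: "j x b (j x x (j y y z)) = 0" for b by (rule 0)
  have y: "j y b (j x x (j y y z)) = 0" for b
    using comm[of y b x x "j y y z"] 0[of y b z] by (simp add: j3_simps)
  have z: "j z z (j x x (j y y z)) = 0"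
    using comm[of z z x x "j y y z"] comm[of z z y y z] by (simp add: j3_simps)
  show ?thesis
    using assms(2,3) x[of b] x[of a] y[of b] y[of a] z j_commute[of a b] by auto
qed

text \<open>
  The independent vectors are \<open>x, y, z\<close>, the vectors \<open>J(a, b) c\<close> (eight of them by the Bianchi
  identity), and three vectors \<open>J(a) J(b) c\<close>; each is listed together with a vector pairing
  nontrivially with it and trivially with all later ones.
\<close>

lemma dim_ge_14:
  assumes jt: "jacobi_tsankov g A" and nz: "F x x y y z z \<noteq> 0"
  shows "14 \<le> dim (UNIV :: 'a set)"
proof -
  note sym = F_symmetries[OF jt] and zero = F_thrice[OF jt]
  define c where "c = F x x y y z z"
  have c: "c \<noteq> 0" using nz by (simp add: c_def)
  \<comment> \<open>All Gram entries with each of \<open>x\<close>, \<open>y\<close>,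
    \<open>z\<close> occurring twice are multiples of \<open>c\<close>: the pattern
    \<open>xx|yy|zz\<close> gives \<open>c\<close>, two equal mixed pairs give
    \<open>- c / 2\<close>, and three different mixed pairs give \<open>c / 4\<close>, the last two
    by the cyclic identity.\<close>
  have perm: "F x x y y z z = c" "F x x z z y y = c" "F y y x x z z = c"
    "F y y z z x x = c" "F z z x x y y = c" "F z z y y x x = c"
    unfolding c_def using sym(4,5) by metis+
  have half: "F a b a b d d = - F d d a a b b / 2" for a b d
  proof -
    have "F a b a b d d = F d d a b a b" by (metis sym(4) sym(5))
    then show ?thesis
      using sym(6)[of d d a b a b] sym(2)[of d d b a a b] by simp
  qed
  have u11: "F x y x y z z = - c / 2" and u22: "F y z y z x x = - c / 2"
    by (simp_all add: half perm)
  have u12: "F x y y z z x = c / 4"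
  proof -
    have "F z x y y x z = F x z x z y y" by (metis sym(1) sym(5))
    moreover have "F z x x y y z = F x y y z z x" by (metis sym(4) sym(5))
    moreover have "F z x y x y z = F z x x y y z" by (rule sym(2))
    ultimately show ?thesis
      using sym(6)[of z x x y y z] half[of x z y] perm by simp
  qed
  have u21: "F y z x y x z = c / 4"
    using u12 sym(4)[of x y y z z x] sym(3) by metis
  have T: "g (j x x (j y y z)) (j a b e) = 0" "g (j y y (j z z x)) (j a b e) = 0"
      "g (j x x (j z z y)) (j a b e) = 0"
    if "a \<in> {x, y, z}" "b \<in> {x, y, z}" for a b e
    using that jacobi_triple_product_0[OF jt, of a x y z b]
      jacobi_triple_product_0[OF jt, of a y z x b] jacobi_triple_product_0[OF jt, of a x z y b]
    by (auto simp: g_simps simp flip: j_selfadjoint)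
  define u1 where "u1 = j x y z"
  define u2 where "u2 = j y z x"
  have TF: "g (j a a (j b b e)) f = F a a b b e f" for a b e f
    unfolding sym(4)[of a a b b e f] by (simp add: F_def j_selfadjoint)
  have T0: "g (j a a (j b b e)) a = 0" "g (j a a (j b b e)) b = 0" for a b e
    by (simp_all add: TF zero)
  have FF: "g (j a b e) (j c d f) = F a b c d e f" for a b c d e f
    by (simp add: F_def)
  define T1 where "T1 = j x x (j y y z)"
  define T2 where "T2 = j y y (j z z x)"
  define T3 where "T3 = j x x (j z z y)"
  have T_M: "g t (j a b e) = 0" "g (j a b e) t = 0"
    if "t \<in> {T1, T2, T3}" "a \<in> {x, y, z}" "b \<in> {x, y, z}" for t a b e
    using that T g_sym[of t] by (auto simp: T1_def T2_def T3_def)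
  have T_W: "g T1 z = c" "g T2 x = c" "g T3 y = c"
    by (simp_all add: T1_def T2_def T3_def TF perm)
  have T_W0: "g T1 x = 0" "g T1 y = 0" "g T2 y = 0" "g T2 z = 0" "g T3 x = 0" "g T3 z = 0"
    by (simp_all add: T1_def T2_def T3_def T0)
  have W_T: "g z T1 = c" "g x T2 = c" "g y T3 = c" "g x T1 = 0" "g y T1 = 0" "g y T2 = 0"
    "g z T2 = 0" "g x T3 = 0" "g z T3 = 0"
    by (simp_all add: T_W T_W0 g_sym[of _ T1] g_sym[of _ T2] g_sym[of _ T3])
  have T_T: "g s t = 0" if "s \<in> {T1, T2, T3}" "t \<in> {T1, T2, T3}" for s t
    using that(2) T_M(1)[OF that(1), of x x] T_M(1)[OF that(1), of y y]
    by (auto simp: T1_def T2_def T3_def)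
  \<comment> \<open>The first six vectors \<open>j a a b\<close> form three hyperbolic pairs, so
    each is paired with its partner. The remaining two have the Gram matrix with diagonal
    \<open>- c / 2\<close> and off-diagonal entry \<open>c / 4\<close>; the partner
    \<open>j x y z + 2 j y z x\<close> is orthogonal to \<open>j x y z\<close> but not to
    \<open>j y z x\<close>.\<close>
  let ?ps = "[(x, T2), (y, T3), (z, T1),
      (j x x y, j z z y), (j z z y, j x x y), (j x x z, j y y z), (j y y z, j x x z),
      (j y y x, j z z x), (j z z x, j y y x),
      (j y z x, j x y z + 2 *\<^sub>R j y z x), (j x y z, j x y z),
      (T1, z), (T2, x), (T3, y)]"
  have "triangular_pairing g ?ps"
    using c
    by (simp add: T_M T_W T_W0 W_T T_T g_simps
        FF perm zero u11 u12 u21 u22)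
  then show ?thesis using length_le_dim by fastforce
qed

lemma two_step_jacobi_nilpotent_if_dim_less_14:
  assumes jt: "jacobi_tsankov g A" and dim: "dim (UNIV :: 'a set) < 14"
  shows "two_step_jacobi_nilpotent g A"
proof -
  have 0: "F x x y y z z = 0" for x y z
    using dim_ge_14[OF jt, of x y z] dim by fastforce
  have "j x x (j y y z) = 0" for x y z
  proof (rule g_eqI)
    fix w
    \<comment> \<open>Polarization in the last pair: \<open>F\<close> is symmetric there, so
      vanishing on the diagonal suffices.\<close>
    have "F x x y y (z + w) (z + w) = F x x y y z z + F x x y y z w + F x x y y w z + F x x y y w w"
      by (simp add: F_def j3_simps g_simps)
    then have "F y y x x z w = 0"
      using 0 F_symmetries(3,4)[OF jt]
      by (metis add.left_neutral add.right_neutral mult_2 mult_eq_0_iff zero_neq_numeral)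
    then show "g (j x x (j y y z)) w = g 0 w"
      by (simp add: F_def j_selfadjoint g_simps)
  qed
  then show ?thesis
    by (simp add: two_step_jacobi_nilpotent_def jacobi_op_eq fun_eq_iff)
qed

section \<open>The kernel of the curvature tensor and two-step nilpotency\<close>

definition kernel :: "'a set" where
  "kernel = {u. \<forall>x y z. A u x y z = 0}"

lemma kernelD:
  assumes "{x, y, z, w} \<inter> kernel \<noteq> {}" shows "A x y z w = 0"
proof -
  have "A u a b c = 0" if "u \<in> kernel" for u a b c
    using that by (auto simp: kernel_def)
  then show ?thesis
    using assms A_skew[of x y z w] A_pair[of x y z w] A_skew[of z w x y] by auto
qed

lemma subspace_kernel: "subspace kernel"
  by (auto simp: subspace_def kernel_def A_simps)

lemma two_step_jacobi_nilpotent_iff: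
  "two_step_jacobi_nilpotent g A \<longleftrightarrow> (\<forall>x y z. j x x (j y y z) = 0)"
  by (simp add: two_step_jacobi_nilpotent_def jacobi_op_eq fun_eq_iff)

text \<open>Pair symmetry moves the inner curvature vector into the first slot of
  \<open>A\<close>.\<close>

lemma two_step_skew_nilpotent_iff:
  "two_step_skew_nilpotent g A \<longleftrightarrow> (\<forall>x y z. R x y z \<in> kernel)"
proof -
  have "two_step_skew_nilpotent g A \<longleftrightarrow> (\<forall>x1 x2 x3 x4 z. R x1 x2 (R x3 x4 z) = 0)"
    by (simp add: two_step_skew_nilpotent_def fun_eq_iff)
  also have "\<dots> \<longleftrightarrow> (\<forall>x1 x2 x3 x4 z w. A x1 x2 (R x3 x4 z) w = 0)"
    by (metis g_R g_eqI g_simps(7))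
  also have "\<dots> \<longleftrightarrow> (\<forall>x y z. R x y z \<in> kernel)"
  proof -
    have *: "A x1 x2 (R x3 x4 z) w = A (R x3 x4 z) w x1 x2" for x1 x2 x3 x4 z w
      by (rule A_pair)
    show ?thesis unfolding kernel_def mem_Collect_eq * by blast
  qed
  finally show ?thesis .
qed

text \<open>The assumption makes \<open>A u a b w\<close> skew in \<open>a\<close> and
  \<open>b\<close>; with the symmetries of \<open>A\<close>, the three terms of the Bianchi identity
  become equal.\<close>

lemma kernel_if_j_0:
  assumes "\<And>x y. j x y u = 0" shows "u \<in> kernel"
proof -
  have anti: "A u a b w = - A u b a w" for a b w
    using arg_cong[OF assms, of "\<lambda>v. g v w" a b] by (simp add: g_j g_simps)
  have "A u a b w = 0" for a b w
  proof -
    have "A a b u w = A u a b w"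
      using A_pair[of a b u w] anti[of w a b] A_skew2[of u a w b] by simp
    moreover have "A b u a w = A u a b w"
      using A_skew[of b u a w] anti[of a b w] by simp
    ultimately show ?thesis
      using A_bianchi[of u a b w] by simp
  qed
  then show ?thesis by (simp add: kernel_def)
qed

text \<open>Forward, polarize both factors and write \<open>R\<close> through \<open>j\<close>:
  every \<open>j a b\<close> then kills every curvature vector. Backward, \<open>j x x y\<close> is
  itself the curvature vector \<open>R y x x\<close>.\<close>

lemma two_step_nilpotent_iff:
  "two_step_jacobi_nilpotent g A \<longleftrightarrow> two_step_skew_nilpotent g A"
proof
  assume "two_step_jacobi_nilpotent g A"
  then have "j x x (j y y z) = 0" for x y z
    by (simp add: two_step_jacobi_nilpotent_iff)
  then have "j a b (j y y z) = 0" for a b y z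
    unfolding j_polar[of a b] by simp
  then have "j a b (j c d z) = 0" for a b c d z
    unfolding j_polar[of c d] j3_simps by simp
  then have "j a b (R x y z) = 0" for a b x y z
    by (simp add: R_eq_j j3_simps)
  then show "two_step_skew_nilpotent g A"
    unfolding two_step_skew_nilpotent_iff by (blast intro: kernel_if_j_0)
next
  assume "two_step_skew_nilpotent g A"
  then have "R x y z \<in> kernel" for x y z
    by (simp add: two_step_skew_nilpotent_iff)
  moreover have "j x x y = R y x x" for x y
    by (simp add: j_def flip: scaleR_2)
  ultimately show "two_step_jacobi_nilpotent g A"
    unfolding two_step_jacobi_nilpotent_iff
    by (auto intro!: g_eqI simp: g_R kernelD g_simps)
qed

text \<open>This lets \<open>A\<close> itself serve as the summand on any subspace.\<close>

lemma curvature_tensors_restrict: "A \<in> curvature_tensors U"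
proof -
  have m: "multilinear4_on U A"
    by (simp add: multilinear4_on_def linear_form_on_def A_simps)
  show ?thesis
    unfolding curvature_tensors_def
    by (intro CollectI conjI ballI; (rule m | rule A_skew | rule A_pair | rule A_bianchi))
qed

end

section \<open>Lagrangian complements of the kernel and decompositions of the model\<close>

text \<open>With \<open>q\<close> a projection onto \<open>U2\<close>, the map
  \<open>s = id - q\<close> kills \<open>U2\<close> and is injective on \<open>U1\<close>; composing
  it with a left inverse gives \<open>p\<close>.\<close>

lemma projection_along:
  fixes U1 U2 :: "'a::real_vector set"
  assumes "subspace U1" "subspace U2" "U1 \<inter> U2 = {0}"
  obtains p where "linear p" "\<And>x. x \<in> U1 \<Longrightarrow> p x = x" "\<And>x. x \<in> U2 \<Longrightarrow> p x = 0"
proof -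
  obtain q where q: "range q \<subseteq> U2" "linear q" "\<forall>v\<in>U2. q v = v"
    using linear_exists_left_inverse_on[OF linear_id assms(2)] by auto
  define s where "s x = x - q x" for x
  have s: "linear s"
    unfolding s_def using q(2) by (intro linear_compose_sub linear_ident)
  have "inj_on s U1"
  proof -
    have "x = 0" if "x \<in> U1" "s x = 0" for x
      using that q(1) assms(3) by (auto simp: s_def)
    then show ?thesis
      using linear_inj_on_iff_eq_0[OF s assms(1)] by blast
  qed
  then obtain r where r: "range r \<subseteq> U1" "linear r" "\<forall>v\<in>U1. r (s v) = v"
    using linear_exists_left_inverse_on[OF s assms(1)] by auto
  show ?thesis
  proof (rule that)
    show "linear (r \<circ> s)" using s r(2) by (rule linear_compose)
  qed (use q r linear_0[OF r(2)] in \<open>auto simp: s_def\<close>)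
qed

context curvature_model
begin

text \<open>Double orthogonality: were \<open>v\<close> outside the span \<open>S\<close> of the
  curvature vectors, some linear form would vanish on \<open>S\<close> but not at \<open>v\<close>.
  Its representing vector \<open>u\<close> is orthogonal to \<open>S\<close>, hence lies in
  \<open>kernel\<close>, contradicting the choice of \<open>v\<close>.\<close>

lemma perp_kernel_subset_kernel:
  assumes "two_step_skew_nilpotent g A" and v: "\<And>k. k \<in> kernel \<Longrightarrow> g v k = 0"
  shows "v \<in> kernel"
proof -
  define S where "S = span {R x y z |x y z. True}"
  have "S \<subseteq> kernel"
    unfolding S_def using assms(1) two_step_skew_nilpotent_iff
    by (intro span_minimal subspace_kernel) auto
  moreover have "v \<in> S"
  proof (rule ccontr)
    assume "v \<notin> S"
    obtain q where q: "range q \<subseteq> S" "linear q" "\<forall>v\<in>S. q v = v"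
      using linear_exists_left_inverse_on[OF linear_id, of S] S_def by auto
    have "v - q v \<noteq> 0" using q(1) \<open>v \<notin> S\<close> by auto
    then obtain w where w: "g (v - q v) w \<noteq> 0"
      using g_eqI[of "v - q v" 0] by (auto simp: g_simps)
    have "linear (\<lambda>x. g (x - q x) w)"
      using q(2) linear_compose[OF linear_compose_sub[OF linear_ident q(2)] g_linear1]
      by (simp add: o_def)
    then obtain u where u: "\<forall>x. g u x = g (x - q x) w"
      using g_representation_ex by blast
    have "R x y z \<in> S" for x y z
      unfolding S_def by (intro span_base) blast
    then have "g u (R x y z) = 0" for x y z
      using q(3) u by (simp add: g_simps)
    then have "A x y z u = 0" for x y z
      by (metis g_R g_sym)
    then have "A u x y z = 0" for x y z
      using A_pair[of u x y z] A_skew2[of y z u x] by simp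
    then have "u \<in> kernel" by (simp add: kernel_def)
    then show False using v u w g_sym by metis
  qed
  ultimately show ?thesis by blast
qed

lemma kernel_isotropic:
  assumes "indecomposable_model g A" and "dim (UNIV :: 'a set) \<noteq> 1"
  shows "totally_isotropic g kernel"
proof -
  have null: "g s s = 0" if s: "s \<in> kernel" for s
  proof (rule ccontr)
    assume ns: "g s s \<noteq> 0"
    define V1 where "V1 = span {s}"
    define V2 where "V2 = {x. g s x = 0}"
    have "subspace V2"
      by (auto simp: V2_def subspace_def g_simps)
    have V1: "V1 \<subseteq> kernel"
      unfolding V1_def using s by (intro span_minimal subspace_kernel) auto
    have V1': "V1 = range (\<lambda>k. k *\<^sub>R s)"
      by (simp add: V1_def span_singleton)
    have "x = (g s x / g s s) *\<^sub>R s + (x - (g s x / g s s) *\<^sub>R s)"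
      "(g s x / g s s) *\<^sub>R s \<in> V1" "x - (g s x / g s s) *\<^sub>R s \<in> V2" for x
      using ns by (auto simp: V1' V2_def g_simps)
    then have "UNIV = {x + y |x y. x \<in> V1 \<and> y \<in> V2}" by blast
    moreover have "subspace V1" by (simp add: V1_def)
    moreover have "V1 \<inter> V2 = {0}"
      using ns subspace_0[OF \<open>subspace V1\<close>] subspace_0[OF \<open>subspace V2\<close>]
      by (auto simp: V1' V2_def g_simps)
    ultimately have "is_direct_sum UNIV V1 V2"
      using \<open>subspace V2\<close> by (simp add: is_direct_sum_def)
    moreover have "\<forall>x\<in>V1. \<forall>y\<in>V2. g x y = 0"
      by (auto simp: V1' V2_def g_simps)
    moreover have "is_tensor_sum V1 V2 A A A"
      unfolding is_tensor_sum_def using V1 kernelD by blast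
    moreover have "s \<in> V1" "s \<noteq> 0"
      using ns by (auto simp: V1_def span_base g_simps)
    then have "V1 \<noteq> {0}" by blast
    \<comment> \<open>The line \<open>V1\<close> carries zero curvature and splits off orthogonally;
      indecomposability leaves only the excluded case that it is the whole space.\<close>
    ultimately have "V2 = {0}"
      using assms(1) curvature_tensors_restrict unfolding indecomposable_model_def by metis
    then have "UNIV = V1"
      using \<open>UNIV = {x + y |x y. x \<in> V1 \<and> y \<in> V2}\<close> by auto
    then have "dim (UNIV :: 'a set) = 1"
      using dim_eq_card[of "{s}" UNIV] \<open>s \<noteq> 0\<close> by (simp add: V1_def)
    then show False using assms(2) by simp
  qed
  have "g x y = 0" if "x \<in> kernel" "y \<in> kernel" for x y
  proof -
    have "g (x + y) (x + y) = g x x + 2 * g x y + g y y"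
      using g_sym[of x y] by (simp add: g_simps)
    then show ?thesis
      using null that subspace_add[OF subspace_kernel] by simp
  qed
  then show ?thesis by (simp add: totally_isotropic_def)
qed

text \<open>\<open>A\<close> descends to the quotient by \<open>kernel\<close>; one slot is replaced
  at a time.\<close>

lemma A_cong_kernel:
  assumes "x - x' \<in> kernel" "y - y' \<in> kernel" "z - z' \<in> kernel" "w - w' \<in> kernel"
  shows "A x y z w = A x' y' z' w'"
proof -
  have "A (x - x') y z w = 0" "A x' (y - y') z w = 0" "A x' y' (z - z') w = 0"
    "A x' y' z' (w - w') = 0"
    using assms by (auto intro: kernelD)
  then show ?thesis by (simp add: A_simps)
qed

lemma isotropic_complement:
  assumes iso: "totally_isotropic g K" and K: "subspace K"
    and perp: "\<And>v. (\<And>k. k \<in> K \<Longrightarrow> g v k = 0) \<Longrightarrow> v \<in> K"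
  obtains W where "is_direct_sum UNIV W K" "totally_isotropic g W"
proof -
  have iso': "g x y = 0" if "x \<in> K" "y \<in> K" for x y
    using iso that by (simp add: totally_isotropic_def)
  obtain q where q: "range q \<subseteq> K" "linear q" "\<forall>v\<in>K. q v = v"
    using linear_exists_left_inverse_on[OF linear_id K] by auto
  define s where "s x = x - q x" for x
  have s: "linear s"
    unfolding s_def using q(2) by (intro linear_compose_sub linear_ident)
  have sK: "s k = 0" if "k \<in> K" for k
    using q that by (simp add: s_def)
  \<comment> \<open>The kernel \<open>range s\<close> of \<open>q\<close> need not be isotropic; adding the \<open>K\<close>-valued correction \<open>T\<close>
    makes it so.\<close>
  have "\<exists>u. \<forall>y. g u y = - (1/2) * g (s x) (s y)" for x
  proof (rule g_representation_ex)
    show "linear (\<lambda>y. - (1/2) * g (s x) (s y))"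
      by (auto simp: linear_iff linear_add[OF s] linear_cmul[OF s] g_simps algebra_simps)
  qed
  then obtain T where T: "\<And>x y. g (T x) y = - (1/2) * g (s x) (s y)"
    by metis
  have T_lin: "T (x + y) = T x + T y" "T (c *\<^sub>R x) = c *\<^sub>R T x" for x y c
    by (auto intro!: g_eqI simp: g_simps T linear_add[OF s] linear_cmul[OF s] algebra_simps)
  have TK: "T x \<in> K" for x
    by (rule perp) (simp add: T sK g_simps)
  have T0: "T k = 0" if "k \<in> K" for k
    by (rule g_eqI) (simp add: T sK[OF that] g_simps)
  \<comment> \<open>As \<open>x = s x + q x\<close>, this is the graph of \<open>T\<close> over the
    kernel of \<open>q\<close>.\<close>
  define W where "W = {x. q x = T x}"
  have "T 0 = 0" using T0 subspace_0[OF K] by simp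
  then have W: "subspace W"
    using linear_0[OF q(2)] linear_add[OF q(2)] linear_cmul[OF q(2)]
    by (auto simp: W_def subspace_def T_lin)
  have iW: "s x + T x \<in> W" for x
  proof -
    have "q (q x) = q x" "q (T x) = T x" using q(1,3) TK by auto
    moreover have "T (s x) = T x"
      using T_lin(1)[of "s x" "q x"] T0[of "q x"] q(1) by (auto simp: s_def)
    ultimately show ?thesis
      using T0[OF TK] by (simp add: W_def T_lin linear_add[OF q(2)] s_def linear_diff[OF q(2)])
  qed
  have "x \<in> {x + y |x y. x \<in> W \<and> y \<in> K}" for x
  proof -
    have "x = (s x + T x) + (q x - T x)" by (simp add: s_def)
    moreover have "q x - T x \<in> K"
      using q(1) TK K by (auto intro: subspace_diff)
    ultimately show ?thesis using iW by blast
  qed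
  then have "UNIV = {x + y |x y. x \<in> W \<and> y \<in> K}" by blast
  moreover have "W \<inter> K = {0}"
    using T0 q(3) subspace_0[OF W] subspace_0[OF K] by (auto simp: W_def)
  ultimately have "is_direct_sum UNIV W K"
    using W K by (simp add: is_direct_sum_def)
  moreover have "totally_isotropic g W"
    unfolding totally_isotropic_def
  proof (intro ballI)
    fix x y assume "x \<in> W" "y \<in> W"
    then have x: "x = s x + T x" and y: "y = s y + T y"
      by (simp_all add: W_def s_def)
    have "g (T x) (T y) = 0" by (simp add: iso' TK)
    moreover have "g (T u) (s v) = - (1/2) * g (s u) (s v)" for u v
    proof -
      have "g (T u) (s v) = g (T u) v - g (T u) (q v)" by (simp add: s_def g_simps)
      then show ?thesis using iso'[OF TK, of "q v"] q(1) T by auto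
    qed
    ultimately have "g (s x + T x) (s y + T y) = 0"
      by (simp add: g_simps g_sym[of "s x" "T y"]) (simp add: g_sym)
    then show "g x y = 0" using x y by simp
  qed
  ultimately show ?thesis by (rule that)
qed

lemma isotropic_splitting_if_skew_nilpotent:
  assumes ind: "indecomposable_model g A" and dim: "dim (UNIV :: 'a set) \<noteq> 1"
    and nil: "two_step_skew_nilpotent g A"
  shows "isotropic_splitting g A"
proof -
  note iso = kernel_isotropic[OF ind dim]
  have iso': "g x y = 0" if "x \<in> kernel" "y \<in> kernel" for x y
    using iso that by (simp add: totally_isotropic_def)
  note perp = perp_kernel_subset_kernel[OF nil]
  obtain W where W: "is_direct_sum UNIV W kernel" "totally_isotropic g W"
    using isotropic_complement[OF iso subspace_kernel perp] by blast
  have sW: "subspace W" and WK: "W \<inter> kernel = {0}"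
    and UW: "UNIV = {x + y |x y. x \<in> W \<and> y \<in> kernel}"
    using W(1) by (auto simp: is_direct_sum_def)
  have "indecomposable_tensor W A"
    unfolding indecomposable_tensor_def
  proof (intro notI, elim exE conjE)
    fix W1 W2 A1 A2
    assume nt: "W1 \<noteq> {0}" "W2 \<noteq> {0}" and ds: "is_direct_sum W W1 W2"
      and ts: "is_tensor_sum W1 W2 A1 A2 A"
    have s1: "subspace W1" and s2: "subspace W2" and W12: "W1 \<inter> W2 = {0}"
      and WW: "W = {x + y |x y. x \<in> W1 \<and> y \<in> W2}"
      using ds by (auto simp: is_direct_sum_def)
    have W1W: "W1 \<subseteq> W" and W2W: "W2 \<subseteq> W"
      using WW subspace_0[OF s1] subspace_0[OF s2] by force+
    define perpK where "perpK U = {k \<in> kernel. \<forall>w\<in>U. g k w = 0}" for U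
    have sp: "subspace (perpK U)" for U
      using subspace_kernel by (auto simp: perpK_def subspace_def g_simps)
    define V where "V U1 U2 = {x + y |x y. x \<in> U1 \<and> y \<in> perpK U2}" for U1 U2
    have V1: "subspace (V W1 W2)" and V2: "subspace (V W2 W1)"
      unfolding V_def by (intro subspace_sums s1 s2 sp)+
    have "V W1 W2 \<inter> V W2 W1 = {0}"
    proof -
      have "x = 0" if xV: "x \<in> V W1 W2" "x \<in> V W2 W1" for x
      proof -
        obtain w1 k1 w2 k2 where x: "x = w1 + k1" "x = w2 + k2" and w: "w1 \<in> W1" "w2 \<in> W2"
          and k: "k1 \<in> perpK W2" "k2 \<in> perpK W1"
          using xV unfolding V_def by blast
        have "w1 - w2 = k2 - k1" using x by (simp add: algebra_simps)
        moreover have "w1 - w2 \<in> W" using w W1W W2W sW by (auto intro: subspace_diff)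
        moreover have "k2 - k1 \<in> kernel"
          using k by (auto simp: perpK_def intro: subspace_diff[OF subspace_kernel])
        ultimately have "w1 - w2 = 0" using WK by (metis IntI singletonD)
        then have eq: "w1 = w2" "k1 = k2" using x by auto
        then have "w1 = 0" using w W12 by auto
        \<comment> \<open>The common vector \<open>k1 = k2\<close> annihilates \<open>W1\<close>,
          \<open>W2\<close> and the isotropic \<open>kernel\<close>, hence everything.\<close>
        have "g k1 v = 0" for v
        proof -
          obtain a b c where "v = a + b + c" "a \<in> W1" "b \<in> W2" "c \<in> kernel"
            using UW WW by blast
          then show ?thesis
            using k eq iso' by (auto simp: perpK_def g_simps)
        qed
        then have "k1 = 0" using g_eqI[of k1 0] by (simp add: g_simps)
        with \<open>w1 = 0\<close> x show ?thesis by simp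
      qed
      then show ?thesis using subspace_0[OF V1] subspace_0[OF V2] by blast
    qed
    moreover have "x \<in> {x + y |x y. x \<in> V W1 W2 \<and> y \<in> V W2 W1}" for x
    proof -
      obtain w1 w2 k where x: "x = w1 + w2 + k" "w1 \<in> W1" "w2 \<in> W2" "k \<in> kernel"
        using UW WW by blast
      \<comment> \<open>To split \<open>k\<close>, project onto \<open>W1\<close> along
        \<open>U\<close> and represent \<open>g k\<close> composed with this projection by
        \<open>u\<close>. Then \<open>u\<close> agrees with \<open>k\<close> on \<open>W1\<close>
        and annihilates \<open>W2\<close>; it also annihilates \<open>kernel\<close>, so it lies in
        \<open>kernel\<close>.\<close>
      define U where "U = {x + y |x y. x \<in> W2 \<and> y \<in> kernel}"
      have sU: "subspace U" unfolding U_def by (intro subspace_sums s2 subspace_kernel)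
      have "W1 \<inter> U = {0}"
      proof -
        have "a = 0" if aW1: "a \<in> W1" and aU: "a \<in> U" for a
        proof -
          obtain b c where a: "a = b + c" "b \<in> W2" "c \<in> kernel"
            using aU unfolding U_def by blast
          then have "a - b \<in> W \<inter> kernel"
            using aW1 W1W W2W subspace_diff[OF sW, of a b] by auto
          then have "a = b" unfolding WK by simp
          then show ?thesis using aW1 a(2) W12 by auto
        qed
        then show ?thesis using subspace_0[OF s1] subspace_0[OF sU] by blast
      qed
      then obtain p where p: "linear p" "\<And>x. x \<in> W1 \<Longrightarrow> p x = x" "\<And>x. x \<in> U \<Longrightarrow> p x = 0"
        using projection_along[OF s1 sU] by metis
      have "linear (\<lambda>x. g k (p x))"
        using linear_compose[OF p(1) g_linear2[of k]] by (simp add: o_def)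
      then obtain u where u: "\<forall>x. g u x = g k (p x)"
        using g_representation_ex by blast
      have U: "kernel \<subseteq> U" "W2 \<subseteq> U"
        using subspace_0[OF s2] subspace_0[OF subspace_kernel] by (force simp: U_def)+
      have uK: "u \<in> kernel"
        using u p(3) U(1) by (intro perp) (auto simp: g_simps)
      then have "u \<in> perpK W2"
        using u p(3) U(2) by (auto simp: perpK_def g_simps)
      moreover have "k - u \<in> perpK W1"
        using u p(2) uK x(4) by (auto simp: perpK_def g_simps intro: subspace_diff[OF subspace_kernel])
      moreover have "x = (w1 + u) + (w2 + (k - u))" using x by simp
      ultimately show ?thesis unfolding V_def using x(2,3) by blast
    qed
    then have "UNIV = {x + y |x y. x \<in> V W1 W2 \<and> y \<in> V W2 W1}"
      by blast
    ultimately have "is_direct_sum UNIV (V W1 W2) (V W2 W1)"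
      unfolding is_direct_sum_def by (intro conjI V1 V2)
    moreover have "\<forall>x\<in>V W1 W2. \<forall>y\<in>V W2 W1. g x y = 0"
    proof (intro ballI)
      fix x y assume "x \<in> V W1 W2" "y \<in> V W2 W1"
      then obtain w1 k1 w2 k2 where *: "x = w1 + k1" "y = w2 + k2" "w1 \<in> W1" "w2 \<in> W2"
        "k1 \<in> perpK W2" "k2 \<in> perpK W1"
        by (auto simp: V_def)
      moreover have "g w1 w2 = 0"
        using W(2) * W1W W2W by (auto simp: totally_isotropic_def)
      ultimately show "g x y = 0"
        using iso' g_sym[of w1 k2] by (auto simp: perpK_def g_simps)
    qed
    moreover have "is_tensor_sum (V W1 W2) (V W2 W1) A A A"
    proof -
      have "A x1 x2 x3 x4 = 0"
        if "{x1, x2, x3, x4} \<subseteq> V W1 W2 \<union> V W2 W1"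
          "{x1, x2, x3, x4} \<inter> V W1 W2 \<noteq> {}" "{x1, x2, x3, x4} \<inter> V W2 W1 \<noteq> {}"
        for x1 x2 x3 x4
      proof -
        have "\<exists>w. x - w \<in> kernel \<and> w \<in> W1 \<union> W2 \<and>
            (x \<in> V W1 W2 \<longrightarrow> w \<in> W1) \<and> (x \<in> V W2 W1 \<longrightarrow> w \<in> W2)"
          if "x \<in> V W1 W2 \<union> V W2 W1" for x
        \<comment> \<open>Zero lies in both pieces, so its representative must lie in both
          \<open>W1\<close> and \<open>W2\<close>; any other vector lies in exactly one
          piece.\<close>
        proof (cases "x = 0")
          case True
          then show ?thesis
            using subspace_0[OF s1] subspace_0[OF s2] subspace_0[OF subspace_kernel]
            by (intro exI[of _ 0]) auto
        next
          case False
          then have "\<not> (x \<in> V W1 W2 \<and> x \<in> V W2 W1)"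
            using \<open>V W1 W2 \<inter> V W2 W1 = {0}\<close> by blast
          then show ?thesis
            using that unfolding V_def perpK_def
            by (smt (verit) Un_iff add_diff_cancel_left' mem_Collect_eq)
        qed
        then obtain f where f: "\<And>x. x \<in> V W1 W2 \<union> V W2 W1 \<Longrightarrow> x - f x \<in> kernel \<and>
            f x \<in> W1 \<union> W2 \<and> (x \<in> V W1 W2 \<longrightarrow> f x \<in> W1) \<and> (x \<in> V W2 W1 \<longrightarrow> f x \<in> W2)"
          by metis
        have "{f x1, f x2, f x3, f x4} \<subseteq> W1 \<union> W2" "{f x1, f x2, f x3, f x4} \<inter> W1 \<noteq> {}"
          "{f x1, f x2, f x3, f x4} \<inter> W2 \<noteq> {}"
          using f that by blast+
        then have "A (f x1) (f x2) (f x3) (f x4) = 0"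
          using ts unfolding is_tensor_sum_def by blast
        moreover have "A x1 x2 x3 x4 = A (f x1) (f x2) (f x3) (f x4)"
          using f that(1) by (intro A_cong_kernel) auto
        ultimately show ?thesis by simp
      qed
      then show ?thesis unfolding is_tensor_sum_def by blast
    qed
    moreover have "W1 \<subseteq> V W1 W2" "W2 \<subseteq> V W2 W1"
      using subspace_0[OF sp] by (force simp: V_def)+
    then have "V W1 W2 \<noteq> {0}" "V W2 W1 \<noteq> {0}"
      using nt subspace_0[OF s1] subspace_0[OF s2] by blast+
    ultimately show False
      using ind curvature_tensors_restrict unfolding indecomposable_model_def by blast
  qed
  moreover have "is_tensor_sum W kernel A (\<lambda>_ _ _ _. 0) A"
    unfolding is_tensor_sum_def using kernelD by blast
  ultimately show ?thesis
    unfolding isotropic_splitting_def using W iso curvature_tensors_restrict by blast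
qed

text \<open>Since \<open>W'\<close> lies in \<open>kernel\<close>, curvature vectors are orthogonal
  to \<open>W'\<close>. Their \<open>W\<close>-component is thus orthogonal to both isotropic
  summands and vanishes, which puts them in \<open>W'\<close>.\<close>

lemma skew_nilpotent_if_isotropic_splitting:
  assumes "isotropic_splitting g A"
  shows "two_step_skew_nilpotent g A"
proof -
  obtain W W' AW where ds: "is_direct_sum UNIV W W'" and iso: "totally_isotropic g W"
    "totally_isotropic g W'" and ts: "is_tensor_sum W W' AW (\<lambda>_ _ _ _. 0) A"
    using assms by (auto simp: isotropic_splitting_def)
  have sum: "\<exists>a b. x = a + b \<and> a \<in> W \<and> b \<in> W'" for x
    using ds unfolding is_direct_sum_def by blast
  have 0: "A d a b c = 0" if "d \<in> W'" "a \<in> W \<union> W'" "b \<in> W \<union> W'" "c \<in> W \<union> W'" for a b c d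
  proof (cases "{d, a, b, c} \<inter> W = {}")
    case True
    then have "{d, a, b, c} \<subseteq> W'" using that by auto
    then show ?thesis using ts by (auto simp: is_tensor_sum_def)
  next
    case False
    then have "{d, a, b, c} \<subseteq> W \<union> W' \<and> {d, a, b, c} \<inter> W \<noteq> {} \<and> {d, a, b, c} \<inter> W' \<noteq> {}"
      using that by auto
    then show ?thesis using ts unfolding is_tensor_sum_def by blast
  qed
  have W'K: "W' \<subseteq> kernel"
  proof
    fix d assume d: "d \<in> W'"
    have "A d x y z = 0" for x y z
    proof -
      obtain x1 x2 y1 y2 z1 z2 where "x = x1 + x2" "y = y1 + y2" "z = z1 + z2"
        "x1 \<in> W" "x2 \<in> W'" "y1 \<in> W" "y2 \<in> W'" "z1 \<in> W" "z2 \<in> W'"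
        using sum by meson
      then show ?thesis by (simp add: A_simps 0[OF d])
    qed
    then show "d \<in> kernel" by (simp add: kernel_def)
  qed
  have "R x y z \<in> kernel" for x y z
  proof -
    obtain a b where ab: "R x y z = a + b" "a \<in> W" "b \<in> W'"
      using sum by blast
    have "g a v = 0" for v
    proof -
      obtain c d where cd: "v = c + d" "c \<in> W" "d \<in> W'" using sum by blast
      have "g (R x y z) d = 0"
        using W'K cd(3) by (auto simp: g_R intro: kernelD)
      then show ?thesis
        using ab cd iso by (simp add: totally_isotropic_def g_simps)
    qed
    then have "a = 0" using g_eqI[of a 0] by (simp add: g_simps)
    then show ?thesis using ab W'K by auto
  qed
  then show ?thesis by (simp add: two_step_skew_nilpotent_iff)
qed

end

text \<open>In dimension 1 the tensor is zero and the model is indecomposable and nilpotent, yet a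
  line with nondegenerate inner product is no sum of totally isotropic subspaces; hence the
  restriction in the last equivalence.\<close>

theorem theorem1p2:
  fixes g :: "'a::real_vector \<Rightarrow> 'a \<Rightarrow> real"
    and A :: "'a tensor4"
    and p q :: nat
  assumes model: "zero_model g A p q"
  shows
    "(jacobi_tsankov g A \<or> mixed_tsankov g A \<longrightarrow>
        (\<forall>x. jacobi_op g A x \<circ> jacobi_op g A x = (\<lambda>_. 0)) \<and>
        (p = 0 \<or> p = 1 \<longrightarrow> A = (\<lambda>_ _ _ _. 0)))
     \<and> (jacobi_tsankov g A \<and> dim (UNIV :: 'a set) < 14 \<longrightarrow> two_step_jacobi_nilpotent g A)
     \<and> (indecomposable_model g A \<longrightarrow>
          (two_step_jacobi_nilpotent g A \<longleftrightarrow> two_step_skew_nilpotent g A) \<and>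
          (dim (UNIV :: 'a set) \<noteq> 1 \<longrightarrow>
             (two_step_skew_nilpotent g A \<longleftrightarrow> isotropic_splitting g A)))"
proof -
  obtain N P where NP: "finite N" "finite P" "N \<inter> P = {}" "card N = p" "card P = q"
    "independent (N \<union> P)" "span (N \<union> P) = UNIV"
    "\<forall>e\<in>N. g e e = - 1" "\<forall>e\<in>P. g e e = 1" "\<forall>e\<in>N \<union> P. \<forall>f\<in>N \<union> P. e \<noteq> f \<longrightarrow> g e f = 0"
    using model unfolding zero_model_def has_signature_def by (elim exE conjE) (rule that)
  note m = model[unfolded zero_model_def, THEN conjunct2]
  note mod = m[THEN conjunct1] m[THEN conjunct2, THEN conjunct1]
    m[THEN conjunct2, THEN conjunct2, THEN conjunct1]
    m[THEN conjunct2, THEN conjunct2, THEN conjunct2, THEN conjunct2]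
  interpret curvature_model g A N P
    by (rule curvature_model.intro)
      (fact mod(1) mod(2)[rule_format] mod(3,4) NP(1-3,6,7) | rule NP(8-10)[rule_format]; assumption)+
  show ?thesis
  proof (intro conjI impI)
    assume ts: "jacobi_tsankov g A \<or> mixed_tsankov g A"
    show "\<forall>x. jacobi_op g A x \<circ> jacobi_op g A x = (\<lambda>_. 0)"
      by (simp add: jacobi_op_eq fun_eq_iff jacobi_squared_0[OF ts])
    assume "p = 0 \<or> p = 1"
    then show "A = (\<lambda>_ _ _ _. 0)"
      using A_eq_0_if_card_N_le_1[OF ts] NP(4) by auto
  next
    assume "jacobi_tsankov g A \<and> dim (UNIV :: 'a set) < 14"
    then show "two_step_jacobi_nilpotent g A"
      by (blast intro: two_step_jacobi_nilpotent_if_dim_less_14)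
  next
    show "two_step_jacobi_nilpotent g A \<longleftrightarrow> two_step_skew_nilpotent g A"
      by (rule two_step_nilpotent_iff)
  next
    assume "indecomposable_model g A" "dim (UNIV :: 'a set) \<noteq> 1"
    then show "two_step_skew_nilpotent g A \<longleftrightarrow> isotropic_splitting g A"
      using isotropic_splitting_if_skew_nilpotent skew_nilpotent_if_isotropic_splitting by blast
  qed
qed

end
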